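(* Let $\{\mathbf{v}_i\}_{i \in I} \subseteq \mathbb{B}^k$. If the collection, viewed as vectors with entries $0,1$ in $\mathbb{R}^k$, is linearly dependent over $\mathbb{R}$, then it is linearly attached in $\mathbb{B}^k$.
   Context: $\mathbb{B} = \{0,1\}$ is the Boolean semiring with $0+x=x$, $1+1=1$, $0\cdot x=0$, $1\cdot 1 = 1$ (i.e. $(\{0,1\},\max,\min)$). $\mathbb{B}^k$ has componentwise operations. A collection $\{\mathbf{v}_i\}_{i\in I} \subseteq \mathbb{B}^k$ is linearly attached if there exist disjoint finite subsets $A, B \subseteq I$, not both empty, and nonzero scalars $(\lambda_a)_{a\in A}$, $(\mu_b)_{b \in B}$ in $\mathbb{B}$ such that $\sum_{a\in A} \lambda_a \mathbf{v}_a = \sum_{b \in B} \mu_b \mathbf{v}_b$ in $\mathbb{B}^k$ (an empty sum being the zero vector). *)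

theory Defs
  imports "HOL-Analysis.Analysis"
begin

text \<open>The Boolean semiring ({0,1}, max, min). The library type of bits is the field with
  two elements, where 1 + 1 = 0, so a separate type is needed.\<close>

datatype boolsr = BZero | BOne

instantiation boolsr :: comm_semiring_1
begin

definition zero_boolsr :: boolsr where "0 = BZero"

definition one_boolsr :: boolsr where "1 = BOne"

fun plus_boolsr :: "boolsr \<Rightarrow> boolsr \<Rightarrow> boolsr" where
  "BZero + y = y"
| "BOne + y = BOne"

fun times_boolsr :: "boolsr \<Rightarrow> boolsr \<Rightarrow> boolsr" where
  "BZero * y = BZero"
| "BOne * y = y"

instance
proof
  fix a b c :: boolsr
  show "a + b + c = a + (b + c)" by (cases a) auto
  show "a + b = b + a" by (cases a; cases b) auto
  show "0 + a = a" by (simp add: zero_boolsr_def)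
  show "a * b * c = a * (b * c)" by (cases a) auto
  show "a * b = b * a" by (cases a; cases b) auto
  show "1 * a = a" by (simp add: one_boolsr_def)
  show "(a + b) * c = a * c + b * c" by (cases a; cases b; cases c) auto
  show "0 * a = 0" by (simp add: zero_boolsr_def)
  show "a * 0 = 0" by (cases a) (auto simp: zero_boolsr_def)
  show "(0::boolsr) \<noteq> 1" by (simp add: zero_boolsr_def one_boolsr_def)
qed

end

lemma boolsr_operations:
  fixes x :: boolsr
  shows "0 + x = x" "(1::boolsr) + 1 = 1" "0 * x = 0" "(1::boolsr) * 1 = 1"
    and "x = 0 \<or> x = 1"
  by (cases x; simp add: zero_boolsr_def one_boolsr_def)+

definition linearly_attached :: "'i set \<Rightarrow> ('i \<Rightarrow> boolsr ^ 'k) \<Rightarrow> bool" where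
  "linearly_attached I v \<longleftrightarrow>
    (\<exists>A B. finite A \<and> finite B \<and> A \<subseteq> I \<and> B \<subseteq> I \<and> A \<inter> B = {} \<and> (A \<noteq> {} \<or> B \<noteq> {}) \<and>
      (\<exists>l m. (\<forall>a\<in>A. l a \<noteq> 0) \<and> (\<forall>b\<in>B. m b \<noteq> 0) \<and>
        (\<Sum>a\<in>A. l a *s v a) = (\<Sum>b\<in>B. m b *s v b)))"

definition real_of_boolsr :: "boolsr \<Rightarrow> real" where
  "real_of_boolsr x = (if x = 0 then 0 else 1)"

definition real_vec_of_boolsr :: "boolsr ^ 'k \<Rightarrow> real ^ 'k" where
  "real_vec_of_boolsr x = (\<chi> j. real_of_boolsr (x $ j))"

text \<open>The library predicate \<^const>\<open>dependent\<close> concerns sets of vectors. For a family, repeated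
  vectors count as dependent, which passing to the range would lose.\<close>

definition dependent_family :: "'i set \<Rightarrow> ('i \<Rightarrow> 'a::real_vector) \<Rightarrow> bool" where
  "dependent_family I w \<longleftrightarrow>
    (\<exists>J c. finite J \<and> J \<subseteq> I \<and> (\<exists>j\<in>J. c j \<noteq> 0) \<and> (\<Sum>j\<in>J. c j *\<^sub>R w j) = 0)"

lemma dependent_family_iff:
  "dependent_family I w \<longleftrightarrow> \<not> inj_on w I \<or> dependent (w ` I)"
proof
  assume "dependent_family I w"
  then obtain J c j where J: "finite J" "J \<subseteq> I" "j \<in> J" "c j \<noteq> 0"
    and s: "(\<Sum>j\<in>J. c j *\<^sub>R w j) = 0"
    unfolding dependent_family_def by blast
  show "\<not> inj_on w I \<or> dependent (w ` I)"
  proof (cases "inj_on w I")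
    case True
    then have inj: "inj_on w J" using J(2) inj_on_subset by blast
    have "(\<Sum>x\<in>w ` J. c (the_inv_into J w x) *\<^sub>R x) = 0"
      using s by (simp add: sum.reindex[OF inj] the_inv_into_f_f[OF inj])
    moreover have "c (the_inv_into J w (w j)) \<noteq> 0"
      using J by (simp add: the_inv_into_f_f[OF inj])
    ultimately have "dependent (w ` I)"
      unfolding dependent_explicit
      by (intro exI[of _ "w ` J"] exI[of _ "\<lambda>x. c (the_inv_into J w x)"]) (use J in auto)
    then show ?thesis ..
  qed simp
next
  assume "\<not> inj_on w I \<or> dependent (w ` I)"
  then consider (inj) "\<not> inj_on w I" | (dep) "inj_on w I" "dependent (w ` I)" by blast
  then show "dependent_family I w"
  proof cases
    case inj
    then obtain i j where ij: "i \<in> I" "j \<in> I" "i \<noteq> j" "w i = w j" by (auto simp: inj_on_def)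
    show ?thesis unfolding dependent_family_def
      by (intro exI[of _ "{i, j}"] exI[of _ "\<lambda>x. if x = i then 1 else -1"]) (use ij in auto)
  next
    case dep
    then obtain S u where S: "finite S" "S \<subseteq> w ` I" "\<exists>x\<in>S. u x \<noteq> 0"
      and s: "(\<Sum>x\<in>S. u x *\<^sub>R x) = 0"
      unfolding dependent_explicit by blast
    obtain J where J: "J \<subseteq> I" "S = w ` J" using S(2) by (auto simp: subset_image_iff)
    have inj: "inj_on w J" using dep(1) J(1) inj_on_subset by blast
    have "finite J" using S(1) J(2) inj finite_imageD by blast
    moreover have "(\<Sum>j\<in>J. u (w j) *\<^sub>R w j) = 0"
      using s by (simp add: J(2) sum.reindex[OF inj])
    ultimately show ?thesis unfolding dependent_family_def
      by (intro exI[of _ J] exI[of _ "\<lambda>j. u (w j)"]) (use J S in auto)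
  qed
qed

end

theory Submission
  imports Defs
begin

text \<open>In a real linear relation among 0-1 vectors, separate the positive coefficients from the
  negative ones. At each coordinate the relation says that two sums of nonnegative terms agree, so
  one has a nonzero term exactly when the other does. Hence the supports of the vectors on either
  side have the same union, and a Boolean sum is determined by the union of the supports.\<close>

lemma boolsr_add_eq_0_iff: "x + y = 0 \<longleftrightarrow> x = 0 \<and> y = 0" for x y :: boolsr
  by (cases x; cases y) (auto simp: zero_boolsr_def)

lemma boolsr_eqI: "(x = 0 \<longleftrightarrow> y = 0) \<Longrightarrow> x = y" for x y :: boolsr
  by (cases x; cases y) (auto simp: zero_boolsr_def)

text \<open>Since \<open>BOne\<close> absorbs under addition, nothing cancels: a single nonzero term
  keeps the whole sum nonzero.\<close>

lemma boolsr_sum_eq_0_iff: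
  fixes f :: "'a \<Rightarrow> boolsr"
  assumes "finite A"
  shows "sum f A = 0 \<longleftrightarrow> (\<forall>a\<in>A. f a = 0)"
  using assms by (induction A rule: finite_induct) (auto simp: boolsr_add_eq_0_iff)

text \<open>If no term were negative, the zero sum would force every term to vanish, yet the term at
  \<open>a\<close> does not. So some term is negative, and as \<open>w\<close> is nonnegative on
  \<open>J\<close>, the sign comes from \<open>c\<close>.\<close>

lemma real_relation_opposite_sign:
  fixes c w :: "'a \<Rightarrow> real"
  assumes "finite J" and "(\<Sum>j\<in>J. c j * w j) = 0" and "\<And>j. j \<in> J \<Longrightarrow> 0 \<le> w j"
    and "a \<in> J" "0 < c a" "w a \<noteq> 0"
  shows "\<exists>b\<in>J. c b < 0 \<and> w b \<noteq> 0"
proof -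
  have "\<exists>b\<in>J. c b * w b < 0"
  proof (rule ccontr)
    assume "\<not> ?thesis"
    then have "\<forall>j\<in>J. c j * w j = 0"
      using assms(1,2) by (subst (asm) sum_nonneg_eq_0_iff) (auto simp: not_less)
    then show False using assms(4-6) by auto
  qed
  then obtain b where "b \<in> J" "c b * w b < 0" by blast
  then show ?thesis using assms(3)[of b] by (intro bexI[of _ b]) (auto simp: mult_less_0_iff)
qed

theorem theorem3p10:
  fixes I :: "'i set" and v :: "'i \<Rightarrow> boolsr ^ 'k"
  assumes "dependent_family I (\<lambda>i. real_vec_of_boolsr (v i))"
  shows "linearly_attached I v"
proof -
  obtain J c j where J: "finite J" "J \<subseteq> I" "j \<in> J" "c j \<noteq> 0"
    and rel: "(\<Sum>j\<in>J. c j *\<^sub>R real_vec_of_boolsr (v j)) = 0"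
    using assms unfolding dependent_family_def by blast
  define A where "A = {j \<in> J. 0 < c j}"
  define B where "B = {j \<in> J. c j < 0}"
  have fin: "finite A" "finite B" using J(1) by (auto simp: A_def B_def)
  have rel_at: "(\<Sum>j\<in>J. c j * real_of_boolsr (v j $ t)) = 0" for t
    using arg_cong[OF rel, of "\<lambda>x. x $ t"] by (simp add: real_vec_of_boolsr_def)
  \<comment> \<open>Negating the coefficients swaps the roles of \<open>A\<close> and
    \<open>B\<close>, so \<open>real_relation_opposite_sign\<close> also serves the converse
    direction of \<open>supports\<close>.\<close>
  then have neg_rel_at: "(\<Sum>j\<in>J. - c j * real_of_boolsr (v j $ t)) = 0" for t
    by (simp add: sum_negf)
  have supports: "(\<exists>a\<in>A. v a $ t \<noteq> 0) \<longleftrightarrow> (\<exists>b\<in>B. v b $ t \<noteq> 0)" for t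
  proof
    assume "\<exists>a\<in>A. v a $ t \<noteq> 0"
    then obtain a where "a \<in> J" "0 < c a" "v a $ t \<noteq> 0" by (auto simp: A_def)
    then obtain b where "b \<in> J" "c b < 0" "real_of_boolsr (v b $ t) \<noteq> 0"
      using real_relation_opposite_sign[OF J(1) rel_at[of t], of a]
      by (fastforce simp: real_of_boolsr_def)
    then show "\<exists>b\<in>B. v b $ t \<noteq> 0" by (auto simp: B_def real_of_boolsr_def)
  next
    assume "\<exists>b\<in>B. v b $ t \<noteq> 0"
    then obtain b where "b \<in> J" "c b < 0" "v b $ t \<noteq> 0" by (auto simp: B_def)
    then obtain a where "a \<in> J" "- c a < 0" "real_of_boolsr (v a $ t) \<noteq> 0"
      using real_relation_opposite_sign[OF J(1) neg_rel_at[of t], of b]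
      by (fastforce simp: real_of_boolsr_def)
    then show "\<exists>a\<in>A. v a $ t \<noteq> 0" by (auto simp: A_def real_of_boolsr_def)
  qed
  \<comment> \<open>The only nonzero Boolean scalar is 1, so the real coefficients survive only
    through their signs.\<close>
  have "(\<Sum>a\<in>A. 1 *s v a) = (\<Sum>b\<in>B. 1 *s v b)"
    unfolding vec_eq_iff
  proof
    fix t
    show "(\<Sum>a\<in>A. 1 *s v a) $ t = (\<Sum>b\<in>B. 1 *s v b) $ t"
      using supports[of t] fin by (intro boolsr_eqI) (auto simp: boolsr_sum_eq_0_iff)
  qed
  \<comment> \<open>The index of a nonzero coefficient keeps \<open>A\<close> and \<open>B\<close>
    from both being empty.\<close>
  moreover have "j \<in> A \<or> j \<in> B" using J(3,4) by (auto simp: A_def B_def)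
  moreover have "A \<subseteq> I" "B \<subseteq> I" "A \<inter> B = {}" using J(2) by (auto simp: A_def B_def)
  ultimately show ?thesis
    unfolding linearly_attached_def using fin
    by (intro exI[of _ A] exI[of _ B] conjI exI[of _ "\<lambda>_. 1"]) auto
qed

end
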